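(* We have $C_{Q_5,\mathbf 1}=6$.
   Context: $\mathbb Z_5=\mathbb Z/5\mathbb Z$ and $Q_5=\{1,-1\}$ is the set of non-zero squares in $\mathbb Z_5$. A sequence of length $k$ in $\mathbb Z_5$ is an element of $\mathbb Z_5^k$. A sequence $(x_1,\ldots,x_k)$ in $\mathbb Z_5$ is called a $(Q_5,\mathbf 1)$-weighted zero-sum sequence if there exist $a_1,\ldots,a_k\in Q_5$ such that $a_1x_1+\cdots+a_kx_k=0$ and $a_1+\cdots+a_k=0$ in $\mathbb Z_5$. The constant $C_{Q_5,\mathbf 1}$ is the least positive integer $k$ such that every sequence in $\mathbb Z_5$ of length $k$ has a (non-empty) $(Q_5,\mathbf 1)$-weighted zero-sum subsequence consisting of consecutive terms. *)

theory Defs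
  imports Main "HOL-Library.Numeral_Type" "HOL-Library.Sublist"
begin

text \<open>The numeral type \<open>5\<close> has exactly five elements and carries the ring structure of the
  integers modulo 5.\<close>

type_synonym Z5 = "5"

definition Q5 :: "Z5 set" where
  "Q5 = {x. x \<noteq> 0 \<and> (\<exists>y. x = y ^ 2)}"

text \<open>The second equation is the condition with weight sequence constantly 1. The empty list
  satisfies this predicate, so non-emptiness is required separately below.\<close>

definition weighted_zero_sum :: "Z5 set \<Rightarrow> Z5 list \<Rightarrow> bool" where
  "weighted_zero_sum A xs \<longleftrightarrow>
     (\<exists>as. length as = length xs \<and> set as \<subseteq> A \<and>
           (\<Sum>i<length xs. as ! i * xs ! i) = 0 \<and> (\<Sum>i<length xs. as ! i) = 0)"

text \<open>The library's \<open>sublist ys xs\<close> says that \<open>ys\<close> is a block of consecutive terms of \<open>xs\<close>.\<close>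

definition has_consecutive_zero_sum :: "Z5 set \<Rightarrow> Z5 list \<Rightarrow> bool" where
  "has_consecutive_zero_sum A xs \<longleftrightarrow>
     (\<exists>ys. ys \<noteq> [] \<and> sublist ys xs \<and> weighted_zero_sum A ys)"

definition C_const :: "Z5 set \<Rightarrow> nat" where
  "C_const A = (LEAST k. 0 < k \<and> (\<forall>xs. length xs = k \<longrightarrow> has_consecutive_zero_sum A xs))"

lemma Z5_UNIV: "(UNIV :: Z5 set) = {0, 1, 2, 3, 4}"
proof -
  have "card {0, 1, 2, 3, 4 :: Z5} = CARD(Z5)" by simp
  then show ?thesis by (metis card_subset_eq finite subset_UNIV)
qed

lemma Q5_eq: "Q5 = {1, - 1}"
proof (rule set_eqI)
  fix x :: Z5
  have *: "y = 0 \<or> y = 1 \<or> y = 2 \<or> y = 3 \<or> y = 4" for y :: Z5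
    using Z5_UNIV by blast
  have "(\<exists>y. x = y ^ 2) \<longleftrightarrow> x \<in> (\<lambda>y. y ^ 2) ` {0, 1, 2, 3, 4}"
    by (metis Z5_UNIV rangeI imageE)
  then show "x \<in> Q5 \<longleftrightarrow> x \<in> {1, - 1}"
    by (auto simp: Q5_def)
qed

end

(* The condition that the weights sum to zero makes the problem translation invariant, so only the
   differences of successive terms matter. If no block of length 2 or 4 is zero-sum, then all
   differences are non-zero and each is plus or minus twice the one two places before it.
   Up to translation, a sequence of length 6 is therefore given by its first two differences and
   three signs, and in each of these finitely many cases the whole sequence is zero-sum. The
   sequence (0, 1, 0, 2, 0) rules out length 5, and its prefixes rule out the smaller lengths. *)

theory Submission
  imports Defs
begin

lemma weighted_zero_sum_sum_list:
  "weighted_zero_sum A xs \<longleftrightarrow>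
     (\<exists>as. length as = length xs \<and> set as \<subseteq> A \<and>
           sum_list (map2 (*) as xs) = 0 \<and> sum_list as = 0)"
  unfolding weighted_zero_sum_def
  by (intro ex_cong conj_cong refl)
     (auto simp: sum_list_sum_nth lessThan_atLeast0 intro!: sum.cong)

text \<open>An accumulator form of weighted zero-sums, on which the simplifier can decide concrete
  instances: \<open>s\<close> is the sum of the weights so far and \<open>t\<close> the weighted sum so far.\<close>

fun reach :: "Z5 list \<Rightarrow> Z5 \<Rightarrow> Z5 \<Rightarrow> bool" where
  "reach [] s t \<longleftrightarrow> s = 0 \<and> t = 0"
| "reach (x # xs) s t \<longleftrightarrow> reach xs (s + 1) (t + x) \<or> reach xs (s - 1) (t - x)"

lemma reach_iff:
  "reach xs s t \<longleftrightarrow>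
     (\<exists>as. length as = length xs \<and> set as \<subseteq> {1, - 1} \<and>
           t + sum_list (map2 (*) as xs) = 0 \<and> s + sum_list as = 0)"
proof (induction xs arbitrary: s t)
  case Nil
  then show ?case by auto
next
  case (Cons x xs)
  show ?case
    unfolding reach.simps Cons.IH length_Cons length_Suc_conv
    by (rule iffI; elim disjE exE conjE; force simp: algebra_simps)
qed

lemma weighted_zero_sum_iff_reach: "weighted_zero_sum Q5 xs \<longleftrightarrow> reach xs 0 0"
  by (simp add: weighted_zero_sum_sum_list reach_iff Q5_eq)

lemma has_consecutive_iff_reach:
  "has_consecutive_zero_sum Q5 xs \<longleftrightarrow> (\<exists>ys\<in>set (sublists xs). ys \<noteq> [] \<and> reach ys 0 0)"
  by (auto simp: has_consecutive_zero_sum_def weighted_zero_sum_iff_reach)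

lemma has_consecutive_zero_sum_mono:
  assumes "has_consecutive_zero_sum A xs" "sublist xs ys"
  shows "has_consecutive_zero_sum A ys"
  using assms sublist_order.order.trans unfolding has_consecutive_zero_sum_def by blast

lemma Z5_cases:
  fixes x :: Z5
  obtains "x = 0" | "x = 1" | "x = 2" | "x = 3" | "x = 4"
  using Z5_UNIV by blast

text \<open>Weights with sum 0 do not exist for lengths 1 and 3. For length 5 they must all be
  equal, giving 3 or -3.\<close>

lemma extremal_sequence_no_zero_sum: "\<not> has_consecutive_zero_sum Q5 [0, 1, 0, 2, 0]"
  by (simp add: has_consecutive_iff_reach)

text \<open>The remaining weights must sum to \<open>- s\<close>, so adding \<open>c\<close> to
  every term shifts the weighted sum by \<open>- c * s\<close>.\<close>

lemma reach_translate: "reach (map ((+) c) xs) s t \<longleftrightarrow> reach xs s (t - c * s)"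
  by (induction xs arbitrary: s t) (auto simp: algebra_simps)

text \<open>The weights are two \<open>1\<close> and two \<open>- 1\<close>, so up to sign the
  weighted sums are \<open>p - r\<close>, \<open>p + r\<close> and
  \<open>p + 2 * q + r\<close>.\<close>

lemma not_reach_four_differences:
  fixes p q r :: Z5
  assumes "p \<noteq> 0" "q \<noteq> 0" "r \<noteq> 0" "\<not> reach [0, p, p + q, p + q + r] 0 0"
  shows "r = 2 * p \<and> q \<noteq> p \<or> r = - 2 * p \<and> q \<noteq> r"
  using assms
  by (cases p rule: Z5_cases; cases q rule: Z5_cases; cases r rule: Z5_cases) simp_all

lemma not_reach_four:
  assumes "\<not> reach [a, b, c, d] 0 0" "a \<noteq> b" "b \<noteq> c" "c \<noteq> d"
  shows "d - c = 2 * (b - a) \<and> c - b \<noteq> b - a \<or> d - c = - 2 * (b - a) \<and> c - b \<noteq> d - c"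
  using assms reach_translate[of a "[0, b - a, (b - a) + (c - b), (b - a) + (c - b) + (d - c)]" 0 0]
  by (intro not_reach_four_differences) simp_all

text \<open>The three disjunctions are the conclusions of \<open>not_reach_four\<close> for the
  three overlapping blocks of length 4.\<close>

lemma reach_six_differences:
  fixes p q r s t :: Z5
  assumes "p \<noteq> 0" "q \<noteq> 0"
    and "r = 2 * p \<and> q \<noteq> p \<or> r = - 2 * p \<and> q \<noteq> r"
    and "s = 2 * q \<and> r \<noteq> q \<or> s = - 2 * q \<and> r \<noteq> s"
    and "t = 2 * r \<and> s \<noteq> r \<or> t = - 2 * r \<and> s \<noteq> t"
  shows "reach [0, p, p + q, p + q + r, p + q + r + s, p + q + r + s + t] 0 0"
  using assms
  by (cases p rule: Z5_cases; cases q rule: Z5_cases; simp; elim disjE; simp)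

lemma length_six_has_consecutive_zero_sum:
  assumes "length xs = 6"
  shows "has_consecutive_zero_sum Q5 xs"
proof (rule ccontr)
  assume no: "\<not> has_consecutive_zero_sum Q5 xs"
  obtain a b c d e f where xs: "xs = [a, b, c, d, e, f]"
    using assms by (auto simp: numeral_eq_Suc length_Suc_conv)
  have *: "\<not> reach ys 0 0" if "ys \<noteq> []" "ys \<in> set (sublists xs)" for ys
    using that no has_consecutive_iff_reach by blast
  have "\<not> reach [a, b] 0 0" "\<not> reach [b, c] 0 0" "\<not> reach [c, d] 0 0"
    "\<not> reach [d, e] 0 0" "\<not> reach [e, f] 0 0"
    by (rule *; simp add: xs)+
  \<comment> \<open>Two weights with sum 0 are opposite.\<close>
  then have neq: "a \<noteq> b" "b \<noteq> c" "c \<noteq> d" "d \<noteq> e" "e \<noteq> f"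
    by auto
  have four: "\<not> reach [a, b, c, d] 0 0" "\<not> reach [b, c, d, e] 0 0" "\<not> reach [c, d, e, f] 0 0"
    by (rule *; simp add: xs)+
  \<comment> \<open>This is \<open>xs\<close> translated by \<open>- a\<close>, written as partial
    sums of differences.\<close>
  define ds where "ds = [0, b - a, (b - a) + (c - b), (b - a) + (c - b) + (d - c),
    (b - a) + (c - b) + (d - c) + (e - d), (b - a) + (c - b) + (d - c) + (e - d) + (f - e)]"
  have "b - a \<noteq> 0" "c - b \<noteq> 0"
    using neq by auto
  then have "reach ds 0 0"
    unfolding ds_def
    by (rule reach_six_differences[OF _ _ not_reach_four[OF four(1) neq(1,2,3)]
          not_reach_four[OF four(2) neq(2,3,4)] not_reach_four[OF four(3) neq(3,4,5)]])
  moreover have "map ((+) a) ds = xs"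
    by (simp add: ds_def xs)
  ultimately have "reach xs 0 0"
    using reach_translate[of a ds 0 0] by simp
  then show False
    using *[of xs] by (simp add: xs)
qed

theorem theorem3p9: "C_const Q5 = 6"
  unfolding C_const_def
proof (rule Least_equality)
  show "0 < (6::nat) \<and> (\<forall>xs. length xs = 6 \<longrightarrow> has_consecutive_zero_sum Q5 xs)"
    using length_six_has_consecutive_zero_sum by simp
next
  fix k :: nat
  assume k: "0 < k \<and> (\<forall>xs. length xs = k \<longrightarrow> has_consecutive_zero_sum Q5 xs)"
  show "6 \<le> k"
  proof (rule ccontr)
    assume "\<not> 6 \<le> k"
    then have "has_consecutive_zero_sum Q5 (take k [0, 1, 0, 2, 0])"
      using k by simp
    then show False
      using extremal_sequence_no_zero_sum has_consecutive_zero_sum_mono sublist_take by blast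
  qed
qed

end
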